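(* Let $\alpha$ be a real number. Let $R_\alpha$ denote the general Randi\'c index of a tree, let $A_\alpha$ denote the sum of the $\alpha$-th powers of the degrees of the vertices at level 1 of a rooted tree, and write $S(n)=S(\tau(n))$ for each of these statistics $S$, where $\tau(n)$ is the rooted tree with Matula number $n$. Then for every positive integer $n$, $$R_\alpha(n)=\begin{cases}0, & \text{if } n=1;\\ R_\alpha(t)+A_\alpha(t)\left[(1+\Omega(t))^\alpha-\Omega(t)^\alpha\right]+(1+\Omega(t))^\alpha, & \text{if } n=p_t \text{ with } t\ge 1;\\ R_\alpha(r)+R_\alpha(s)+A_\alpha(r)\left[\Omega(n)^\alpha-\Omega(r)^\alpha\right]+A_\alpha(s)\left[\Omega(n)^\alpha-\Omega(s)^\alpha\right], & \text{if } n=rs \text{ with } r,s\ge 2,\end{cases}$$ where for $t=1$ (so that $\Omega(t)=0$ and $A_\alpha(t)=0$) the term $A_\alpha(t)\left[(1+\Omega(t))^\alpha-\Omega(t)^\alpha\right]$ is read as $0$.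
   Context: For $m\ge 1$ let $p_m$ denote the $m$-th prime ($p_1=2,p_2=3,p_3=5,\dots$). For a positive integer $n$, $\Omega(n)$ is the number of prime divisors of $n$ counted with multiplicity. Rooted trees are finite and considered up to isomorphism of rooted trees. The Matula number $\mu(T)$ of a rooted tree $T$ is defined recursively: $\mu(T)=1$ for the one-vertex tree; otherwise, if $T_1,\dots,T_d$ are the subtrees rooted at the vertices adjacent to the root of $T$, then $\mu(T)=p_{\mu(T_1)}p_{\mu(T_2)}\cdots p_{\mu(T_d)}$. The map $\mu$ is a bijection from rooted trees to positive integers, and $\tau(n)$ denotes the rooted tree with Matula number $n$. Equivalently: $\tau(1)$ is the one-vertex tree; $\tau(p_t)$ is obtained from $\tau(t)$ by adding a new vertex, which becomes the root, joined by an edge to the root of $\tau(t)$; and, for $r,s\ge 2$, $\tau(rs)$ is obtained from $\tau(r)$ and $\tau(s)$ by identifying their roots. For a statistic $S$ on rooted trees, $S(n)$ means $S(\tau(n))$. The degree $\deg(i)$ of a vertex $i$ is the number of edges incident with $i$. The general Randi\'c index of a tree is $R_\alpha=\sum_{ij} (\deg(i)\deg(j))^\alpha$, the sum being over all edges $ij$. The level of a vertex is its distance from the root; $A_\alpha(T)=\sum\deg(i)^\alpha$ over all vertices $i$ of $T$ at level 1, with degrees taken in $T$. *)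

theory Defs
  imports
    Complex_Main
    "HOL-Library.Infinite_Set"
    "HOL-Computational_Algebra.Primes"
begin

definition nth_prime :: "nat \<Rightarrow> nat" where
  \<comment> \<open>\<^const>\<open>enumerate\<close> counts from 0, whereas the first prime is \<open>nth_prime 1 = 2\<close>;
      the value at 0 is irrelevant.\<close>
  "nth_prime m = enumerate {p. prime p} (m - 1)"

definition big_omega :: "nat \<Rightarrow> nat" where
  "big_omega n = size (prime_factorization n)"

record 'v rooted_graph =
  verts :: "'v set"
  edges :: "'v set set"
  root_vertex :: 'v

definition adj :: "'v rooted_graph \<Rightarrow> ('v \<times> 'v) set" where
  "adj G = {(u, v). {u, v} \<in> edges G}"

definition finite_simple_graph :: "'v rooted_graph \<Rightarrow> bool" where
  "finite_simple_graph G \<longleftrightarrow> finite (verts G) \<and> (\<forall>e \<in> edges G. e \<subseteq> verts G \<and> card e = 2)"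

definition connected_graph :: "'v rooted_graph \<Rightarrow> bool" where
  "connected_graph G \<longleftrightarrow> (\<forall>u \<in> verts G. \<forall>v \<in> verts G. (u, v) \<in> (adj G)\<^sup>*)"

definition is_cycle :: "'v rooted_graph \<Rightarrow> 'v list \<Rightarrow> bool" where
  "is_cycle G c \<longleftrightarrow> length c \<ge> 3 \<and> distinct c \<and>
     (\<forall>i. Suc i < length c \<longrightarrow> (c ! i, c ! Suc i) \<in> adj G) \<and> (last c, hd c) \<in> adj G"

definition rooted_tree :: "'v rooted_graph \<Rightarrow> bool" where
  "rooted_tree T \<longleftrightarrow> finite_simple_graph T \<and> root_vertex T \<in> verts T \<and>
     connected_graph T \<and> (\<nexists>c. is_cycle T c)"

definition vdegree :: "'v rooted_graph \<Rightarrow> 'v \<Rightarrow> nat" where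
  "vdegree G v = card {e \<in> edges G. v \<in> e}"

definition vdist :: "'v rooted_graph \<Rightarrow> 'v \<Rightarrow> 'v \<Rightarrow> nat" where
  "vdist G u v = (LEAST k. (u, v) \<in> adj G ^^ k)"

definition level :: "'v rooted_graph \<Rightarrow> 'v \<Rightarrow> nat" where
  "level T v = vdist T (root_vertex T) v"

text \<open>The subtree of \<open>T\<close> rooted at a neighbour \<open>v\<close> of the root is the connected component of
  \<open>v\<close> in \<open>T\<close> with its root removed.\<close>

definition branch_verts :: "'v rooted_graph \<Rightarrow> 'v \<Rightarrow> 'v set" where
  "branch_verts T v =
     {w. (v, w) \<in> {(x, y) \<in> adj T. x \<noteq> root_vertex T \<and> y \<noteq> root_vertex T}\<^sup>*}"

definition branch :: "'v rooted_graph \<Rightarrow> 'v \<Rightarrow> 'v rooted_graph" where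
  "branch T v = \<lparr>verts = branch_verts T v, edges = {e \<in> edges T. e \<subseteq> branch_verts T v},
     root_vertex = v\<rparr>"

lemma card_branch_less:
  assumes "rooted_tree T" and "(root_vertex T, v) \<in> adj T"
  shows "card (verts (branch T v)) < card (verts T)"
proof -
  have E: "x \<in> verts T \<and> y \<in> verts T \<and> x \<noteq> y" if "(x, y) \<in> adj T" for x y
  proof -
    have "{x, y} \<in> edges T"
      using that by (simp add: adj_def)
    then have "{x, y} \<subseteq> verts T \<and> card {x, y} = 2"
      using assms(1) unfolding rooted_tree_def finite_simple_graph_def by blast
    then show ?thesis by (cases "x = y") auto
  qed
  have "w \<in> verts T - {root_vertex T}" if "w \<in> branch_verts T v" for w
  proof -
    have "(v, w) \<in> {(x, y) \<in> adj T. x \<noteq> root_vertex T \<and> y \<noteq> root_vertex T}\<^sup>*"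
      using that unfolding branch_verts_def by blast
    then show ?thesis
      by (cases rule: rtranclE) (use E assms(2) in blast)+
  qed
  then have "verts (branch T v) \<subseteq> verts T - {root_vertex T}"
    unfolding branch_def rooted_graph.simps by blast
  moreover have "root_vertex T \<in> verts T"
    using assms(1) unfolding rooted_tree_def by blast
  ultimately have "verts (branch T v) \<subset> verts T"
    by blast
  moreover have "finite (verts T)"
    using assms(1) unfolding rooted_tree_def finite_simple_graph_def by blast
  ultimately show ?thesis
    by (rule psubset_card_mono[rotated])
qed

text \<open>The Matula number; the empty product gives 1 for the one-vertex tree. The value 0 marks
  graphs that are not rooted trees.\<close>

function matula :: "'v rooted_graph \<Rightarrow> nat" where
  "matula T = (if rooted_tree T
     then \<Prod>v \<in> {v. (root_vertex T, v) \<in> adj T}. nth_prime (matula (branch T v)) else 0)"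
  by pat_completeness auto
termination
  by (relation "measure (\<lambda>T. card (verts T))") (auto simp: card_branch_less)

declare matula.simps [simp del]

text \<open>The Matula number determines a rooted tree up to isomorphism, so \<open>tau n\<close> picks a
  representative of the isomorphism class. Every finite rooted tree has an isomorphic copy with
  vertices of type \<^typ>\<open>nat\<close>, and the statistics below are isomorphism invariant, so
  the choice does not matter.\<close>

definition tau :: "nat \<Rightarrow> nat rooted_graph" where
  "tau n = (SOME T. rooted_tree T \<and> matula T = n)"

text \<open>An edge is a two-element set \<open>{i, j}\<close>, so the inner product is
  \<open>deg i * deg j\<close>.\<close>

definition randic :: "real \<Rightarrow> 'v rooted_graph \<Rightarrow> real" where
  "randic \<alpha> T = (\<Sum>e \<in> edges T. (\<Prod>i \<in> e. real (vdegree T i)) powr \<alpha>)"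

definition level1_power_sum :: "real \<Rightarrow> 'v rooted_graph \<Rightarrow> real" where
  "level1_power_sum \<alpha> T = (\<Sum>i \<in> {i \<in> verts T. level T i = 1}. real (vdegree T i) powr \<alpha>)"

definition R :: "real \<Rightarrow> nat \<Rightarrow> real" where
  "R \<alpha> n = randic \<alpha> (tau n)"

definition A :: "real \<Rightarrow> nat \<Rightarrow> real" where
  "A \<alpha> n = level1_power_sum \<alpha> (tau n)"

end

theory Submission
  imports Defs "HOL-Library.Countable"
begin

text \<open>
  Removing the root of a rooted tree \<open>T\<close> leaves its branches. An edge at the root contributes
  \<open>(deg \<rho> * deg v) powr \<alpha>\<close>, so these edges together contribute \<open>(deg \<rho>) powr \<alpha>\<close> times the
  level 1 sum of \<open>T\<close>. An edge inside a branch keeps its contribution unless it meets the root of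
  that branch, whose degree in \<open>T\<close> is one more than in the branch. So the Randic index is this
  root term plus a sum over the branches, and the level 1 statistic is itself a sum over the
  branches (\<open>randic_branches\<close>, \<open>level1_power_sum_branches\<close>).

  The prime factors of the Matula number of \<open>T\<close>, with multiplicity, are the primes indexed by the
  Matula numbers of the branches; in particular \<open>\<Omega>\<close> is the degree of the root. Sums over
  branches are therefore sums over prime factors (\<open>sum_root_nbrs_matula\<close>), and
  \<open>A\<close> and \<open>R\<close> take the shape
    \<open>A n = (\<Sum>p. (1 + \<Omega> t\<^sub>p) powr \<alpha>)\<close>  and  \<open>R n = \<Omega> n powr \<alpha> * A n + (\<Sum>p. g t\<^sub>p)\<close>,
  where \<open>p\<close> runs through the prime factors of \<open>n\<close>, \<open>t\<^sub>p\<close> is the index of the prime \<open>p\<close>, and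
  \<open>g t\<close> is the right-hand side of the rule for \<open>n = p\<^sub>t\<close> without its last term
  (\<open>A_prime_factorization\<close>, \<open>R_prime_factorization\<close>). A prime \<open>n\<close> has one summand, which gives
  that rule. For \<open>n = r * s\<close> the sums over the prime factors of \<open>r\<close> and \<open>s\<close> add up, so
  \<open>A n = A r + A s\<close>, and only the coefficient \<open>\<Omega> n powr \<alpha>\<close> has to be corrected.

  Two facts make \<open>\<tau>\<close> usable. Every positive integer is the Matula number of a tree
  (\<open>ex_list_tree_matula\<close>), so the choice in \<open>\<tau>\<close> succeeds; and trees with equal Matula numbers
  have equal statistics (\<open>level1_power_sum_matula\<close>, \<open>randic_eq_R\<close>), so the branches of \<open>\<tau> n\<close>
  may be replaced by the representatives chosen for their Matula numbers. The latter holds by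
  induction on the Matula number, along the formulas above.
\<close>

section \<open>Walks and cycles\<close>

lemma adj_sym: "(u, v) \<in> adj G \<Longrightarrow> (v, u) \<in> adj G"
  by (simp add: adj_def insert_commute)

lemma rtrancl_map:
  assumes "(a, b) \<in> r\<^sup>*" and "\<And>x y. (x, y) \<in> r \<Longrightarrow> (g x, g y) \<in> s"
  shows "(g a, g b) \<in> s\<^sup>*"
  using assms(1) by induction (auto intro: assms(2) rtrancl_into_rtrancl)

text \<open>A first step \<open>x \<rightarrow> y\<close> is put in front of a repetition-free path from \<open>y\<close>; if that path
  already visits \<open>x\<close>, its part before \<open>x\<close> is dropped instead.\<close>

lemma rtrancl_imp_distinct_path:
  assumes "(a, b) \<in> r\<^sup>*"
  obtains c where "c \<noteq> []" "hd c = a" "last c = b" "distinct c"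
    "successively (\<lambda>x y. (x, y) \<in> r) c"
proof -
  from assms have "\<exists>c. c \<noteq> [] \<and> hd c = a \<and> last c = b \<and> distinct c \<and>
    successively (\<lambda>x y. (x, y) \<in> r) c"
  proof (induction rule: converse_rtrancl_induct)
    case base
    have "[b] \<noteq> [] \<and> hd [b] = b \<and> last [b] = b \<and> distinct [b] \<and>
      successively (\<lambda>x y. (x, y) \<in> r) [b]" by simp
    then show ?case by blast
  next
    case (step x y)
    then obtain c where c: "c \<noteq> []" "hd c = y" "last c = b" "distinct c"
      "successively (\<lambda>x y. (x, y) \<in> r) c" by blast
    show ?case
    proof (cases "x \<in> set c")
      case True
      then obtain c1 c2 where "c = c1 @ x # c2" by (meson split_list)
      with c have "x # c2 \<noteq> [] \<and> hd (x # c2) = x \<and> last (x # c2) = b \<and> distinct (x # c2) \<and>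
        successively (\<lambda>x y. (x, y) \<in> r) (x # c2)"
        by (auto simp: successively_append_iff)
      then show ?thesis by blast
    next
      case False
      with c step.hyps(1) have "x # c \<noteq> [] \<and> hd (x # c) = x \<and> last (x # c) = b \<and>
        distinct (x # c) \<and> successively (\<lambda>x y. (x, y) \<in> r) (x # c)"
        by (auto simp: successively_Cons)
      then show ?thesis by blast
    qed
  qed
  then show thesis using that by blast
qed

lemma is_cycle_iff_successively:
  "is_cycle G c \<longleftrightarrow> length c \<ge> 3 \<and> distinct c \<and> successively (\<lambda>x y. (x, y) \<in> adj G) c \<and>
     (last c, hd c) \<in> adj G"
  by (auto simp: is_cycle_def successively_conv_nth)

lemma is_cycle_map:
  assumes "is_cycle G c" and "inj_on g (set c)"
    and "\<And>x y. (x, y) \<in> adj G \<Longrightarrow> (g x, g y) \<in> adj H"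
  shows "is_cycle H (map g c)"
proof -
  have "c \<noteq> []" using assms(1) by (auto simp: is_cycle_def)
  then show ?thesis
    using assms by (auto simp: is_cycle_def distinct_map last_map hd_map)
qed

text \<open>On a cycle, a vertex at which the height \<open>h\<close> is maximal would have two different lower
  neighbours: its predecessor and its successor. This is how concrete trees, in which a lower
  neighbour is a parent, are seen to be acyclic.\<close>

lemma not_is_cycle_if_unique_lower_neighbour:
  fixes h :: "'v \<Rightarrow> nat"
  assumes neq: "\<And>u v. (u, v) \<in> adj G \<Longrightarrow> h u \<noteq> h v"
    and uniq: "\<And>u v w. \<lbrakk>(u, v) \<in> adj G; (u, w) \<in> adj G; h v < h u; h w < h u\<rbrakk> \<Longrightarrow> v = w"
  shows "\<not> is_cycle G c"
proof
  assume cyc: "is_cycle G c"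
  define n where "n = length c"
  have n: "n \<ge> 3" and dist: "distinct c" using cyc by (auto simp: is_cycle_def n_def)
  have next_adj: "(c ! i, c ! (Suc i mod n)) \<in> adj G" if "i < n" for i
  proof (cases "Suc i < n")
    case True
    with cyc show ?thesis by (simp add: is_cycle_def n_def)
  next
    case False
    with that have i: "i = n - 1" "Suc i = n" by auto
    with n have "c \<noteq> []" by (auto simp: n_def)
    then show ?thesis
      using cyc i by (simp add: is_cycle_def last_conv_nth hd_conv_nth n_def)
  qed
  have "Max (h ` set c) \<in> h ` set c" using n by (intro Max_in) (auto simp: n_def)
  then obtain u where u: "u \<in> set c" "h u = Max (h ` set c)" by (metis imageE)
  then obtain i where i: "i < n" "c ! i = u" by (auto simp: in_set_conv_nth n_def)
  have top: "h v \<le> h u" if "v \<in> set c" for v using that u by simp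
  \<comment> \<open>the indices after and before \<open>i\<close> on the cycle; they differ since \<open>n \<ge> 3\<close>\<close>
  define j where "j = Suc i mod n"
  define k where "k = (if i = 0 then n - 1 else i - 1)"
  have jk: "j < n" "k < n" "j \<noteq> k" "Suc k mod n = i"
    using n i(1) unfolding j_def k_def
    by (auto simp: mod_Suc split: if_splits)
  have adj: "(u, c ! j) \<in> adj G" "(u, c ! k) \<in> adj G"
    using next_adj[OF i(1)] next_adj[OF jk(2)] jk(4) i(2) adj_sym unfolding j_def by auto
  have "h (c ! j) < h u" "h (c ! k) < h u"
    using top[of "c ! j"] top[of "c ! k"] neq[OF adj(1)] neq[OF adj(2)] jk n_def
    by (auto simp: order.strict_iff_order)
  with uniq[OF adj] have "c ! j = c ! k" by blast
  with dist jk show False by (simp add: nth_eq_iff_index_eq n_def)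
qed

section \<open>Splitting a rooted tree at its root\<close>

abbreviation root_nbrs :: "'v rooted_graph \<Rightarrow> 'v set" where
  "root_nbrs T \<equiv> {v. (root_vertex T, v) \<in> adj T}"

abbreviation off_root_adj :: "'v rooted_graph \<Rightarrow> ('v \<times> 'v) set" where
  "off_root_adj T \<equiv> {(x, y) \<in> adj T. x \<noteq> root_vertex T \<and> y \<noteq> root_vertex T}"

lemma verts_branch [simp]: "verts (branch T v) = branch_verts T v"
  and root_branch [simp]: "root_vertex (branch T v) = v"
  and edges_branch: "edges (branch T v) = {e \<in> edges T. e \<subseteq> branch_verts T v}"
  by (simp_all add: branch_def)

lemma adj_branch:
  "(x, y) \<in> adj (branch T v) \<longleftrightarrow> (x, y) \<in> adj T \<and> x \<in> branch_verts T v \<and> y \<in> branch_verts T v"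
  by (auto simp: adj_def edges_branch)

lemma branch_verts_self: "v \<in> branch_verts T v"
  by (simp add: branch_verts_def)

lemma branch_verts_step:
  assumes "w \<in> branch_verts T v" "(w, y) \<in> off_root_adj T"
  shows "y \<in> branch_verts T v"
  using rtrancl_into_rtrancl[of v w "off_root_adj T" y] assms
  unfolding branch_verts_def by simp

context
  fixes T :: "'v rooted_graph"
  assumes tree: "rooted_tree T"
begin

lemma adj_vertsD:
  assumes "(x, y) \<in> adj T"
  shows "x \<in> verts T" "y \<in> verts T" "x \<noteq> y"
proof -
  have "{x, y} \<subseteq> verts T" "card {x, y} = 2"
    using assms tree unfolding adj_def rooted_tree_def finite_simple_graph_def by auto
  then show "x \<in> verts T" "y \<in> verts T" "x \<noteq> y" by auto
qed

lemma edge_pairE: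
  assumes "e \<in> edges T"
  obtains x y where "e = {x, y}" "x \<noteq> y" "(x, y) \<in> adj T"
proof -
  have "card e = 2"
    using assms tree unfolding rooted_tree_def finite_simple_graph_def by auto
  with assms that show thesis by (auto simp: card_2_iff adj_def)
qed

lemma finite_verts: "finite (verts T)"
  using tree unfolding rooted_tree_def finite_simple_graph_def by auto

lemma finite_edges: "finite (edges T)"
proof (rule finite_subset)
  show "edges T \<subseteq> Pow (verts T)"
    using tree unfolding rooted_tree_def finite_simple_graph_def by auto
qed (use finite_verts in simp)

lemma finite_root_nbrs: "finite (root_nbrs T)"
  by (rule finite_subset[OF _ finite_verts]) (auto dest: adj_vertsD)

lemma branch_vertsD:
  assumes "v \<in> root_nbrs T" and "w \<in> branch_verts T v"
  shows "w \<in> verts T" "w \<noteq> root_vertex T"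
proof -
  have "(v, w) \<in> (off_root_adj T)\<^sup>*" using assms(2) by (simp add: branch_verts_def)
  then have "w \<in> verts T \<and> w \<noteq> root_vertex T"
    by (cases rule: rtranclE) (use assms(1) adj_vertsD(2,3) in blast)+
  then show "w \<in> verts T" "w \<noteq> root_vertex T" by auto
qed

lemma branch_verts_closed:
  assumes "v \<in> root_nbrs T" "w \<in> branch_verts T v" "(w, y) \<in> adj T" "y \<noteq> root_vertex T"
  shows "y \<in> branch_verts T v"
  using branch_verts_step[of w T v y] branch_vertsD(2)[OF assms(1,2)] assms(2-4) by simp

lemma off_root_sym: "sym ((off_root_adj T)\<^sup>*)"
  by (rule sym_rtrancl) (auto intro!: symI dest: adj_sym)

text \<open>Two branches that meet would be joined by a path avoiding the root, and the root would close
  this path to a cycle.\<close>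

lemma branch_verts_disjoint:
  assumes v: "v \<in> root_nbrs T" "v' \<in> root_nbrs T"
    and w: "w \<in> branch_verts T v" "w \<in> branch_verts T v'"
  shows "v = v'"
proof (rule ccontr)
  assume neq: "v \<noteq> v'"
  let ?r = "off_root_adj T"
  have "(v, w) \<in> ?r\<^sup>*" "(v', w) \<in> ?r\<^sup>*" using w by (simp_all add: branch_verts_def)
  then have "(v, v') \<in> ?r\<^sup>*" 
    using symD[OF off_root_sym, of v' w] rtrancl_trans[of v w ?r v'] by simp
  then obtain c where c: "c \<noteq> []" "hd c = v" "last c = v'" "distinct c"
    "successively (\<lambda>x y. (x, y) \<in> ?r) c" by (rule rtrancl_imp_distinct_path)
  have "length c \<noteq> 1" using c(2,3) neq by (auto simp: length_Suc_conv)
  with c(1) have len: "length c \<ge> 2" by (cases c) (auto simp: Suc_le_eq)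
  have root: "root_vertex T \<notin> set c"
  proof
    assume "root_vertex T \<in> set c"
    then obtain i where i: "i < length c" "c ! i = root_vertex T"
      by (auto simp: in_set_conv_nth)
    have nth: "Suc j < length c \<Longrightarrow> (c ! j, c ! Suc j) \<in> ?r" for j
      using c(5) by (simp add: successively_conv_nth)
    show False
    proof (cases "Suc i < length c")
      case True then show False using nth[of i] i by auto
    next
      case False
      with len i have "Suc (i - 1) = i" by auto
      then show False using nth[of "i - 1"] i by auto
    qed
  qed
  have "successively (\<lambda>x y. (x, y) \<in> adj T) c"
    by (rule successively_mono[OF c(5)]) auto
  then have "is_cycle T (root_vertex T # c)"
    using c root len v adj_sym[of "root_vertex T" v' T]
    by (auto simp: is_cycle_iff_successively successively_Cons)
  then show False using tree by (auto simp: rooted_tree_def)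
qed

lemma branch_verts_cover:
  assumes "w \<in> verts T" "w \<noteq> root_vertex T"
  obtains v where "v \<in> root_nbrs T" "w \<in> branch_verts T v"
proof -
  have "(root_vertex T, w) \<in> (adj T)\<^sup>*"
    using assms tree unfolding rooted_tree_def connected_graph_def by auto
  then have "w = root_vertex T \<or> (\<exists>v \<in> root_nbrs T. w \<in> branch_verts T v)"
  proof induction
    case (step y z)
    show ?case
    proof (cases "y = root_vertex T \<or> z = root_vertex T")
      case True
      with step.hyps show ?thesis using branch_verts_self[of z T] by auto
    next
      case False
      with step show ?thesis using branch_verts_closed by blast
    qed
  qed simp
  with assms that show thesis by blast
qed

lemma rooted_tree_branch:
  assumes "v \<in> root_nbrs T"
  shows "rooted_tree (branch T v)"
proof -
  let ?B = "branch T v"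
  have sub: "branch_verts T v \<subseteq> verts T" using branch_vertsD[OF assms] by blast
  have simple: "finite_simple_graph ?B"
    using tree finite_subset[OF sub finite_verts]
    by (auto simp: rooted_tree_def finite_simple_graph_def edges_branch)
  have "(v, w) \<in> (adj ?B)\<^sup>*" if "w \<in> branch_verts T v" for w
  proof -
    from that have "(v, w) \<in> (off_root_adj T)\<^sup>*" by (simp add: branch_verts_def)
    then have "w \<in> branch_verts T v \<and> (v, w) \<in> (adj ?B)\<^sup>*"
    proof induction
      case base then show ?case by (simp add: branch_verts_self)
    next
      case (step y z)
      then have "z \<in> branch_verts T v" by (blast intro: branch_verts_step[of y T v z])
      moreover from this step have "(y, z) \<in> adj ?B" by (auto simp: adj_branch)
      ultimately show ?case using step.IH by (auto intro: rtrancl_into_rtrancl)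
    qed
    then show ?thesis by blast
  qed
  moreover have "sym ((adj ?B)\<^sup>*)" by (rule sym_rtrancl) (auto intro: symI adj_sym)
  ultimately have conn: "connected_graph ?B"
    unfolding connected_graph_def by (metis verts_branch symD rtrancl_trans)
  have "\<not> is_cycle ?B c" for c
  proof
    assume "is_cycle ?B c"
    then have "is_cycle T (map id c)" by (rule is_cycle_map) (auto simp: adj_branch)
    then show False using tree by (auto simp: rooted_tree_def)
  qed
  then show ?thesis
    using simple conn branch_verts_self[of v T] by (simp add: rooted_tree_def)
qed

lemma edges_eq_root_edges_Un_branch_edges:
  "edges T = (\<lambda>v. {root_vertex T, v}) ` root_nbrs T \<union> (\<Union>v \<in> root_nbrs T. edges (branch T v))"
    (is "_ = ?U")
proof
  show "?U \<subseteq> edges T" by (auto simp: adj_def edges_branch)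
  show "edges T \<subseteq> ?U"
  proof
    fix e assume e: "e \<in> edges T"
    then obtain x y where xy: "e = {x, y}" "x \<noteq> y" "(x, y) \<in> adj T" by (rule edge_pairE)
    consider "x = root_vertex T" | "y = root_vertex T"
      | "x \<noteq> root_vertex T" "y \<noteq> root_vertex T" by blast
    then show "e \<in> ?U"
    proof cases
      case 1 then show ?thesis using xy by auto
    next
      case 2 then show ?thesis using xy adj_sym[of x y T] by auto
    next
      case 3
      obtain v where v: "v \<in> root_nbrs T" "x \<in> branch_verts T v"
        using branch_verts_cover[of x] adj_vertsD[OF xy(3)] 3 by blast
      then have "y \<in> branch_verts T v" using branch_verts_closed xy 3 by blast
      then have "e \<in> edges (branch T v)" using e v xy by (simp add: edges_branch)
      with v show ?thesis by blast
    qed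
  qed
qed

lemma branch_edge_nonempty:
  assumes "e \<in> edges (branch T v)"
  obtains w where "w \<in> e" "w \<in> branch_verts T v"
  using assms by (auto simp: edges_branch elim!: edge_pairE)

text \<open>The decomposition of the edge set is disjoint: branches avoid the root, and an edge inside two
  branches would make them meet.\<close>

lemma sum_edges:
  fixes f :: "'v set \<Rightarrow> real"
  shows "(\<Sum>e \<in> edges T. f e) =
    (\<Sum>v \<in> root_nbrs T. f {root_vertex T, v}) + (\<Sum>v \<in> root_nbrs T. \<Sum>e \<in> edges (branch T v). f e)"
proof -
  let ?rootE = "(\<lambda>v. {root_vertex T, v}) ` root_nbrs T"
  have fin: "finite (edges (branch T v))" for v
    using finite_edges by (simp add: edges_branch)
  have "?rootE \<inter> (\<Union>v \<in> root_nbrs T. edges (branch T v)) = {}"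
    using branch_vertsD by (fastforce simp: edges_branch)
  then have "(\<Sum>e \<in> edges T. f e) = sum f ?rootE + (\<Sum>e \<in> (\<Union>v \<in> root_nbrs T. edges (branch T v)). f e)"
    unfolding edges_eq_root_edges_Un_branch_edges using finite_root_nbrs fin
    by (intro sum.union_disjoint) auto
  also have "sum f ?rootE = (\<Sum>v \<in> root_nbrs T. f {root_vertex T, v})"
    by (subst sum.reindex) (auto simp: inj_on_def doubleton_eq_iff)
  also have "(\<Sum>e \<in> (\<Union>v \<in> root_nbrs T. edges (branch T v)). f e) =
      (\<Sum>v \<in> root_nbrs T. \<Sum>e \<in> edges (branch T v). f e)"
  proof (rule sum.UNION_disjoint)
    show "\<forall>v \<in> root_nbrs T. \<forall>v' \<in> root_nbrs T. v \<noteq> v' \<longrightarrow>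
        edges (branch T v) \<inter> edges (branch T v') = {}"
    proof (intro ballI impI equals0I)
      fix v v' e
      assume v: "v \<in> root_nbrs T" "v' \<in> root_nbrs T" "v \<noteq> v'"
        and e: "e \<in> edges (branch T v) \<inter> edges (branch T v')"
      from e obtain w where w: "w \<in> e" "w \<in> branch_verts T v"
        using branch_edge_nonempty by (metis IntD1)
      from e w have "w \<in> branch_verts T v'" by (auto simp: edges_branch)
      with v w show False using branch_verts_disjoint by blast
    qed
  qed (use finite_root_nbrs fin in auto)
  finally show ?thesis .
qed

lemma vdegree_root: "vdegree T (root_vertex T) = card (root_nbrs T)"
proof -
  have "{e \<in> edges T. root_vertex T \<in> e} = (\<lambda>v. {root_vertex T, v}) ` root_nbrs T"
  proof -
    have "root_vertex T \<notin> e" if "v \<in> root_nbrs T" "e \<in> edges (branch T v)" for v e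
      using that branch_vertsD(2) by (auto simp: edges_branch)
    then show ?thesis unfolding edges_eq_root_edges_Un_branch_edges by auto
  qed
  then show ?thesis
    by (simp add: vdegree_def card_image inj_on_def doubleton_eq_iff)
qed

text \<open>Passing from \<open>T\<close> to a branch deletes only the edge that joins the branch to the root of
  \<open>T\<close>; disjointness of the branches excludes a second such edge.\<close>

lemma vdegree_branch:
  assumes v: "v \<in> root_nbrs T" and w: "w \<in> branch_verts T v"
  shows "vdegree T w = vdegree (branch T v) w + (if w = v then 1 else 0)"
proof -
  have root: "w \<noteq> root_vertex T" using branch_vertsD[OF v w] by simp
  have iff: "e \<in> edges T \<and> w \<in> e \<longleftrightarrow>
    e \<in> edges (branch T v) \<and> w \<in> e \<or> e = {root_vertex T, w} \<and> w = v" for e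
  proof
    assume e: "e \<in> edges T \<and> w \<in> e"
    then obtain x y where "e = {x, y}" "x \<noteq> y" "(x, y) \<in> adj T" by (auto elim: edge_pairE)
    with e obtain y where y: "e = {w, y}" "(w, y) \<in> adj T"
      using adj_sym[of x y T] by (auto simp: insert_commute)
    show "e \<in> edges (branch T v) \<and> w \<in> e \<or> e = {root_vertex T, w} \<and> w = v"
    proof (cases "y = root_vertex T")
      case True
      with y have "w \<in> root_nbrs T" using adj_sym[of w y T] by simp
      then have "w = v" using branch_verts_disjoint[OF _ v branch_verts_self w] by simp
      with y True show ?thesis by (simp add: insert_commute)
    next
      case False
      then have "y \<in> branch_verts T v" using branch_verts_closed[OF v w] y by blast
      with y w e show ?thesis by (simp add: edges_branch)
    qed
  qed (use v in \<open>auto simp: edges_branch adj_def\<close>)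
  let ?E = "{e \<in> edges (branch T v). w \<in> e}"
  have "finite ?E" using finite_edges by (simp add: edges_branch)
  moreover have "{root_vertex T, w} \<notin> ?E"
    using branch_vertsD[OF v] by (auto simp: edges_branch)
  moreover have "{e \<in> edges T. w \<in> e} = (if w = v then insert {root_vertex T, w} ?E else ?E)"
    using iff by auto
  ultimately show ?thesis by (cases "w = v") (simp_all add: vdegree_def del: mem_Collect_eq)
qed

lemma level_eq_1_iff:
  assumes "w \<in> verts T"
  shows "level T w = 1 \<longleftrightarrow> w \<in> root_nbrs T"
proof -
  let ?P = "\<lambda>k. (root_vertex T, w) \<in> adj T ^^ k"
  have "(root_vertex T, w) \<in> (adj T)\<^sup>*"
    using assms tree unfolding rooted_tree_def connected_graph_def by auto
  then have "\<exists>k. ?P k" by (simp add: rtrancl_power)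
  then have least: "?P (Least ?P)" by (rule LeastI_ex)
  show ?thesis
  proof
    assume "level T w = 1"
    with least show "w \<in> root_nbrs T" by (simp add: level_def vdist_def)
  next
    assume w: "w \<in> root_nbrs T"
    then have "\<not> ?P 0" using adj_vertsD(3)[of "root_vertex T" w] by auto
    have "Least ?P = 1"
    proof (rule Least_equality)
      show "?P 1" using w by simp
      show "1 \<le> k" if "?P k" for k using that \<open>\<not> ?P 0\<close> by (cases k) auto
    qed
    then show "level T w = 1" by (simp add: level_def vdist_def)
  qed
qed

lemma level1_power_sum_root_nbrs:
  "level1_power_sum \<alpha> T = (\<Sum>v \<in> root_nbrs T. real (vdegree T v) powr \<alpha>)"
proof -
  have "{i \<in> verts T. level T i = 1} = root_nbrs T"
    using level_eq_1_iff adj_vertsD(2) by blast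
  then show ?thesis by (simp add: level1_power_sum_def)
qed

text \<open>Replacing the degree of the root affects only the root edges, and the weights of their other
  endpoints sum to the level 1 statistic. For a branch, with \<open>d\<close> the degrees in the
  surrounding tree, this yields the bracket \<open>(1 + \<Omega>) powr \<alpha> - \<Omega> powr \<alpha>\<close>.\<close>

lemma randic_change_root_degree:
  assumes d: "\<And>w. w \<in> verts T \<Longrightarrow> w \<noteq> root_vertex T \<Longrightarrow> d w = vdegree T w"
  shows "(\<Sum>e \<in> edges T. (\<Prod>i \<in> e. real (d i)) powr \<alpha>) = randic \<alpha> T
    + level1_power_sum \<alpha> T *
        (real (d (root_vertex T)) powr \<alpha> - real (vdegree T (root_vertex T)) powr \<alpha>)"
proof -
  let ?w = "\<lambda>f e. (\<Prod>i \<in> e. real (f i)) powr \<alpha>" and ?\<rho> = "root_vertex T"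
  have inner: "?w d e = ?w (vdegree T) e" if "v \<in> root_nbrs T" "e \<in> edges (branch T v)" for v e
  proof -
    have "d i = vdegree T i" if "i \<in> e" for i
      using that \<open>e \<in> edges (branch T v)\<close> branch_vertsD[OF \<open>v \<in> root_nbrs T\<close>] d
      by (auto simp: edges_branch)
    then show ?thesis by simp
  qed
  have outer: "?w f {?\<rho>, v} = real (f ?\<rho>) powr \<alpha> * real (f v) powr \<alpha>"
    if "v \<in> root_nbrs T" for f :: "'v \<Rightarrow> nat" and v
    using that adj_vertsD(3)[of ?\<rho> v] by (simp add: powr_mult)
  have dv: "d v = vdegree T v" if "v \<in> root_nbrs T" for v
    using that d adj_vertsD[of ?\<rho> v] by auto
  have "(\<Sum>e \<in> edges T. ?w d e) - randic \<alpha> T =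
     (\<Sum>v \<in> root_nbrs T. ?w d {?\<rho>, v}) - (\<Sum>v \<in> root_nbrs T. ?w (vdegree T) {?\<rho>, v})"
    using inner by (simp add: randic_def sum_edges)
  also have "\<dots> = level1_power_sum \<alpha> T * (real (d ?\<rho>) powr \<alpha> - real (vdegree T ?\<rho>) powr \<alpha>)"
    using outer dv
    by (simp add: level1_power_sum_root_nbrs sum_distrib_left sum_distrib_right algebra_simps
        flip: sum_subtractf)
  finally show ?thesis by simp
qed

end

lemma level1_power_sum_branches:
  assumes "rooted_tree T"
  shows "level1_power_sum \<alpha> T =
    (\<Sum>v \<in> root_nbrs T. (1 + real (card (root_nbrs (branch T v)))) powr \<alpha>)"
proof -
  have "real (vdegree T v) = 1 + real (card (root_nbrs (branch T v)))" if "v \<in> root_nbrs T" for v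
    using vdegree_branch[OF assms that branch_verts_self]
      vdegree_root[OF rooted_tree_branch[OF assms that]] by simp
  then show ?thesis by (simp add: level1_power_sum_root_nbrs[OF assms])
qed

lemma randic_branches:
  assumes T: "rooted_tree T"
  shows "randic \<alpha> T = real (card (root_nbrs T)) powr \<alpha> * level1_power_sum \<alpha> T
    + (\<Sum>v \<in> root_nbrs T. randic \<alpha> (branch T v) + level1_power_sum \<alpha> (branch T v) *
        ((1 + real (card (root_nbrs (branch T v)))) powr \<alpha>
          - real (card (root_nbrs (branch T v))) powr \<alpha>))"
proof -
  let ?w = "\<lambda>e. (\<Prod>i \<in> e. real (vdegree T i)) powr \<alpha>"
  have "?w {root_vertex T, v} = real (card (root_nbrs T)) powr \<alpha> * real (vdegree T v) powr \<alpha>"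
    if "v \<in> root_nbrs T" for v
    using that adj_vertsD(3)[OF T, of "root_vertex T" v]
    by (simp add: powr_mult vdegree_root[OF T])
  then have "(\<Sum>v \<in> root_nbrs T. ?w {root_vertex T, v}) =
      real (card (root_nbrs T)) powr \<alpha> * level1_power_sum \<alpha> T"
    by (simp add: level1_power_sum_root_nbrs[OF T] sum_distrib_left)
  moreover have "(\<Sum>e \<in> edges (branch T v). ?w e) = randic \<alpha> (branch T v)
      + level1_power_sum \<alpha> (branch T v) *
        ((1 + real (card (root_nbrs (branch T v)))) powr \<alpha>
          - real (card (root_nbrs (branch T v))) powr \<alpha>)" if v: "v \<in> root_nbrs T" for v
    using randic_change_root_degree[OF rooted_tree_branch[OF T v], of "vdegree T" \<alpha>]
      vdegree_branch[OF T v] vdegree_root[OF rooted_tree_branch[OF T v]] branch_verts_self[of v T]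
    by simp
  ultimately show ?thesis
    unfolding randic_def[of \<alpha> T] sum_edges[OF T] by simp
qed

section \<open>Matula numbers and prime factorizations\<close>

lemma prime_nth_prime: "prime (nth_prime m)"
  using enumerate_in_set[OF primes_infinite] unfolding nth_prime_def by auto

lemma inj_on_nth_prime: "inj_on nth_prime {1..}"
proof (rule inj_onI)
  fix m k :: nat
  assume "m \<in> {1..}" "k \<in> {1..}" "nth_prime m = nth_prime k"
  moreover from this have "m - 1 = k - 1"
    using strict_mono_eq[OF strict_mono_enumerate[OF primes_infinite]] by (simp add: nth_prime_def)
  \<comment> \<open>truncated subtraction makes \<open>nth_prime 0 = nth_prime 1\<close>; hence the restriction to \<open>{1..}\<close>\<close>
  ultimately show "m = k" by simp
qed

text \<open>This makes the Matula numbers of the branches smaller than that of the tree, and the indices of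
  the prime factors of \<open>n\<close> smaller than \<open>n\<close>: the two facts on which the inductions for
  \<open>randic_eq_R\<close> and \<open>ex_list_tree_matula\<close> rest.\<close>

lemma less_nth_prime: "m < nth_prime m"
proof -
  have "k + 2 \<le> enumerate {p::nat. prime p} k" for k
  proof (induction k)
    case 0
    then show ?case
      using enumerate_in_set[OF primes_infinite, of 0]
        prime_ge_2_nat[of "enumerate {p::nat. prime p} 0"] by simp
  next
    case (Suc k)
    then show ?case using enumerate_step[OF primes_infinite, of k] by simp
  qed
  from this[of "m - 1"] show ?thesis by (simp add: nth_prime_def)
qed

definition prime_index :: "nat \<Rightarrow> nat" where
  "prime_index = inv_into {1..} nth_prime"

lemma prime_index_nth_prime: "m \<ge> 1 \<Longrightarrow> prime_index (nth_prime m) = m"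
  unfolding prime_index_def by (rule inv_into_f_f[OF inj_on_nth_prime]) simp

lemma prime_index:
  assumes "prime p"
  shows "nth_prime (prime_index p) = p" "prime_index p \<ge> 1"
proof -
  obtain k where "enumerate {p::nat. prime p} k = p"
    using enumerate_Ex[OF primes_infinite, of p] assms by auto
  then have "nth_prime (Suc k) = p" by (simp add: nth_prime_def)
  then have "p \<in> nth_prime ` {1..}" by force
  then show "nth_prime (prime_index p) = p" "prime_index p \<ge> 1"
    using f_inv_into_f[of p nth_prime "{1..}"] inv_into_into[of p nth_prime "{1..}"]
    by (simp_all add: prime_index_def)
qed

lemma matula_rooted_tree:
  "rooted_tree T \<Longrightarrow> matula T = (\<Prod>v \<in> root_nbrs T. nth_prime (matula (branch T v)))"
  by (simp add: matula.simps)

lemma matula_pos: "rooted_tree T \<Longrightarrow> matula T \<ge> 1"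
  using prime_gt_0_nat[OF prime_nth_prime]
  by (simp add: matula_rooted_tree Suc_le_eq prod_pos)

lemma matula_branch_less:
  assumes "rooted_tree T" "v \<in> root_nbrs T"
  shows "matula (branch T v) < matula T"
proof -
  have "nth_prime (matula (branch T v)) dvd matula T"
    unfolding matula_rooted_tree[OF assms(1)] using assms finite_root_nbrs
    by (intro dvd_prodI) auto
  then have "nth_prime (matula (branch T v)) \<le> matula T"
    using matula_pos[OF assms(1)] by (simp add: dvd_imp_le)
  with less_nth_prime show ?thesis by (rule less_le_trans)
qed

lemma prime_factorization_matula:
  assumes "rooted_tree T"
  shows "prime_factorization (matula T) =
    image_mset (\<lambda>v. nth_prime (matula (branch T v))) (mset_set (root_nbrs T))"
  unfolding matula_rooted_tree[OF assms] prod_unfold_prod_mset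
  by (rule prime_factorization_prod_mset_primes) (auto simp: prime_nth_prime)

lemma big_omega_matula: "rooted_tree T \<Longrightarrow> big_omega (matula T) = card (root_nbrs T)"
  by (simp add: big_omega_def prime_factorization_matula)

lemma sum_root_nbrs_matula:
  assumes "rooted_tree T"
  shows "(\<Sum>v \<in> root_nbrs T. g (matula (branch T v))) =
    (\<Sum>p \<in># prime_factorization (matula T). g (prime_index p) :: real)"
proof -
  have "prime_index (nth_prime (matula (branch T v))) = matula (branch T v)"
    if "v \<in> root_nbrs T" for v
    by (rule prime_index_nth_prime[OF matula_pos[OF rooted_tree_branch[OF assms that]]])
  then show ?thesis
    by (auto simp: prime_factorization_matula[OF assms] sum_unfold_sum_mset
        image_mset.compositionality comp_def finite_root_nbrs[OF assms]
        intro!: arg_cong[where f = sum_mset] image_mset_cong)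
qed

section \<open>Every positive integer is a Matula number\<close>

definition map_graph :: "('v \<Rightarrow> 'w) \<Rightarrow> 'v rooted_graph \<Rightarrow> 'w rooted_graph" where
  "map_graph f G = \<lparr>verts = f ` verts G, edges = (`) f ` edges G, root_vertex = f (root_vertex G)\<rparr>"

lemma map_graph_simps [simp]:
  "verts (map_graph f G) = f ` verts G" "edges (map_graph f G) = (`) f ` edges G"
  "root_vertex (map_graph f G) = f (root_vertex G)"
  by (simp_all add: map_graph_def)

lemma adj_map_graph:
  assumes "inj f"
  shows "(a, b) \<in> adj (map_graph f G) \<longleftrightarrow> (\<exists>x y. a = f x \<and> b = f y \<and> (x, y) \<in> adj G)"
proof
  assume "(a, b) \<in> adj (map_graph f G)"
  then obtain e where e: "e \<in> edges G" "{a, b} = f ` e" by (auto simp: adj_def)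
  then obtain x y where xy: "a = f x" "b = f y" by (metis imageE insertI1 insertI2)
  with e have "f ` e = f ` {x, y}" by simp
  then have "e = {x, y}" by (simp only: inj_image_eq_iff[OF assms])
  with e xy show "\<exists>x y. a = f x \<and> b = f y \<and> (x, y) \<in> adj G" by (auto simp: adj_def)
next
  assume "\<exists>x y. a = f x \<and> b = f y \<and> (x, y) \<in> adj G"
  then obtain x y where "{a, b} = f ` {x, y}" "{x, y} \<in> edges G" by (auto simp: adj_def)
  then show "(a, b) \<in> adj (map_graph f G)" by (simp add: adj_def del: image_insert)
qed

lemma branch_verts_map_graph:
  assumes f: "inj f"
  shows "branch_verts (map_graph f G) (f v) = f ` branch_verts G v"
proof
  let ?H = "map_graph f G"
  show "f ` branch_verts G v \<subseteq> branch_verts ?H (f v)"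
  proof
    fix b assume "b \<in> f ` branch_verts G v"
    then obtain w where w: "b = f w" "(v, w) \<in> (off_root_adj G)\<^sup>*"
      by (auto simp: branch_verts_def)
    have "(f v, f w) \<in> (off_root_adj ?H)\<^sup>*"
      by (rule rtrancl_map[OF w(2)]) (auto simp: adj_map_graph[OF f] inj_eq[OF f])
    with w show "b \<in> branch_verts ?H (f v)" by (simp add: branch_verts_def)
  qed
  show "branch_verts ?H (f v) \<subseteq> f ` branch_verts G v"
  proof
    fix b assume "b \<in> branch_verts ?H (f v)"
    then have "(f v, b) \<in> (off_root_adj ?H)\<^sup>*" by (simp add: branch_verts_def)
    then show "b \<in> f ` branch_verts G v"
    proof induction
      case base show ?case by (rule imageI[OF branch_verts_self])
    next
      case (step b c)
      then obtain x y where xy: "b = f x" "c = f y" "(x, y) \<in> adj G"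
        by (auto simp: adj_map_graph[OF f])
      with step f have "x \<in> branch_verts G v" "(x, y) \<in> off_root_adj G"
        by (auto simp: inj_eq)
      then have "y \<in> branch_verts G v" by (rule branch_verts_step)
      with xy show ?case by blast
    qed
  qed
qed

lemma branch_map_graph:
  assumes f: "inj f"
  shows "branch (map_graph f G) (f v) = map_graph f (branch G v)"
proof -
  have "{e \<in> (`) f ` edges G. e \<subseteq> f ` branch_verts G v} =
      (`) f ` {e \<in> edges G. e \<subseteq> branch_verts G v}"
    using inj_image_subset_iff[OF f] by auto
  then show ?thesis
    by (simp add: branch_def map_graph_def branch_verts_map_graph[OF f, unfolded map_graph_def])
qed

lemma root_nbrs_map_graph: "inj f \<Longrightarrow> root_nbrs (map_graph f G) = f ` root_nbrs G"
  by (auto simp: adj_map_graph inj_eq)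

lemma rooted_tree_map_graph:
  assumes f: "inj f" and T: "rooted_tree T"
  shows "rooted_tree (map_graph f T)"
proof -
  let ?H = "map_graph f T"
  have "card (f ` e) = card e" for e by (rule card_image[OF inj_on_subset[OF f]]) simp
  then have "finite_simple_graph ?H"
    using T by (auto simp: rooted_tree_def finite_simple_graph_def)
  moreover have "connected_graph ?H"
  proof -
    have "(f x, f y) \<in> (adj ?H)\<^sup>*" if "x \<in> verts T" "y \<in> verts T" for x y
    proof (rule rtrancl_map[where r = "adj T"])
      show "(x, y) \<in> (adj T)\<^sup>*"
        using that T by (simp add: rooted_tree_def connected_graph_def)
    qed (auto simp: adj_map_graph[OF f])
    then show ?thesis by (auto simp: connected_graph_def)
  qed
  moreover have "\<not> is_cycle ?H c" for c
  proof
    assume cyc: "is_cycle ?H c"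
    have "set c \<subseteq> range f"
    proof
      fix u assume "u \<in> set c"
      then obtain i where i: "i < length c" "u = c ! i" by (auto simp: in_set_conv_nth)
      have "\<exists>w. (u, w) \<in> adj ?H"
      proof (cases "Suc i < length c")
        case True
        with cyc i show ?thesis by (auto simp: is_cycle_def)
      next
        case False
        with i have "c \<noteq> []" "i = length c - 1" by auto
        with i have "u = last c" by (simp add: last_conv_nth)
        with cyc show ?thesis by (auto simp: is_cycle_def)
      qed
      then show "u \<in> range f" by (auto simp: adj_map_graph[OF f])
    qed
    then have "is_cycle T (map (inv f) c)"
      using cyc by (intro is_cycle_map[where G = ?H])
        (auto simp: adj_map_graph[OF f] inv_f_f[OF f] intro: inj_on_inv_into)
    then show False using T by (auto simp: rooted_tree_def)
  qed
  ultimately show ?thesis using T by (auto simp: rooted_tree_def)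
qed

text \<open>A branch of the relabelled tree is the relabelled branch, so the recursion defining \<open>matula\<close>
  gives the same value. The relabellings to come append a fixed label to lists, which embeds a
  tree as a branch of a larger one, and code lists as natural numbers.\<close>

lemma matula_map_graph:
  assumes f: "inj f" and T: "rooted_tree T"
  shows "matula (map_graph f T) = matula T"
  using T
proof (induction T rule: matula.induct)
  case (1 T)
  have "matula (map_graph f T) =
      (\<Prod>v \<in> f ` root_nbrs T. nth_prime (matula (branch (map_graph f T) v)))"
    by (simp only: matula_rooted_tree[OF rooted_tree_map_graph[OF f "1.prems"]]
        root_nbrs_map_graph[OF f])
  also have "\<dots> = (\<Prod>v \<in> root_nbrs T. nth_prime (matula (map_graph f (branch T v))))"
    by (subst prod.reindex) (use f in \<open>auto simp: branch_map_graph inj_on_def\<close>)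
  also have "\<dots> = matula T"
    unfolding matula_rooted_tree[OF "1.prems"]
    by (rule prod.cong) (use "1.IH" "1.prems" rooted_tree_branch[OF "1.prems"] in auto)
  finally show ?case .
qed

text \<open>A vertex is a list of labels recording the way down from the root, most recent step first, so
  that the parent of \<open>x # l\<close> is \<open>l\<close> and the first step, which tells the branch, is the last
  entry.\<close>

definition list_tree :: "nat list set \<Rightarrow> bool" where
  "list_tree V \<longleftrightarrow> finite V \<and> [] \<in> V \<and> (\<forall>x l. x # l \<in> V \<longrightarrow> l \<in> V)"

definition list_graph :: "nat list set \<Rightarrow> nat list rooted_graph" where
  "list_graph V = \<lparr>verts = V, edges = {{x # l, l} | x l. x # l \<in> V}, root_vertex = []\<rparr>"

lemma list_graph_simps [simp]:
  "verts (list_graph V) = V" "edges (list_graph V) = {{x # l, l} | x l. x # l \<in> V}"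
  "root_vertex (list_graph V) = []"
  by (simp_all add: list_graph_def)

lemma adj_list_graph:
  "(u, w) \<in> adj (list_graph V) \<longleftrightarrow> (\<exists>x. u = x # w \<and> u \<in> V) \<or> (\<exists>x. w = x # u \<and> w \<in> V)"
  by (auto simp: adj_def doubleton_eq_iff)

lemma rooted_tree_list_graph:
  assumes "list_tree V"
  shows "rooted_tree (list_graph V)"
proof -
  let ?G = "list_graph V"
  have V: "finite V" "[] \<in> V" "\<And>x l. x # l \<in> V \<Longrightarrow> l \<in> V" using assms by (auto simp: list_tree_def)
  then have "finite_simple_graph ?G"
    by (auto simp: finite_simple_graph_def)
  moreover have "(w, []) \<in> (adj ?G)\<^sup>*" if "w \<in> V" for w
    using that
  proof (induction w)
    case (Cons x w)
    then have "(x # w, w) \<in> adj ?G" "(w, []) \<in> (adj ?G)\<^sup>*" using V by (auto simp: adj_list_graph)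
    then show ?case by (rule converse_rtrancl_into_rtrancl)
  qed simp
  moreover have "sym ((adj ?G)\<^sup>*)" by (rule sym_rtrancl) (auto intro: symI adj_sym)
  ultimately have "finite_simple_graph ?G" "connected_graph ?G"
    unfolding connected_graph_def list_graph_simps by (blast, metis symD rtrancl_trans)
  moreover have "\<not> is_cycle ?G c" for c
    by (rule not_is_cycle_if_unique_lower_neighbour[where h = length])
      (auto simp: adj_list_graph)
  ultimately show ?thesis using V by (simp add: rooted_tree_def)
qed

text \<open>The trees \<open>W 0, \<dots>, W (d - 1)\<close> hung below a new root.\<close>

definition graft :: "nat \<Rightarrow> (nat \<Rightarrow> nat list set) \<Rightarrow> nat list set" where
  "graft d W = insert [] (\<Union>i<d. (\<lambda>l. l @ [i]) ` W i)"

lemma append_in_graft: "l @ [i] \<in> graft d W \<longleftrightarrow> i < d \<and> l \<in> W i"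
  by (auto simp: graft_def)

lemma list_tree_graft:
  assumes "\<And>i. i < d \<Longrightarrow> list_tree (W i)"
  shows "list_tree (graft d W)"
  unfolding list_tree_def
proof (intro conjI allI impI)
  show "finite (graft d W)" using assms by (auto simp: graft_def list_tree_def)
  show "[] \<in> graft d W" by (simp add: graft_def)
next
  fix x l assume l: "x # l \<in> graft d W"
  show "l \<in> graft d W"
  proof (cases l rule: rev_cases)
    case Nil then show ?thesis by (simp add: graft_def)
  next
    case (snoc l' i)
    with l have "(x # l') @ [i] \<in> graft d W" by simp
    then have "i < d" "x # l' \<in> W i" unfolding append_in_graft by auto
    with assms have "l' \<in> W i" by (auto simp: list_tree_def)
    with snoc \<open>i < d\<close> show ?thesis by (simp add: append_in_graft)
  qed
qed

lemma root_nbrs_graft: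
  assumes "\<And>i. i < d \<Longrightarrow> list_tree (W i)"
  shows "root_nbrs (list_graph (graft d W)) = (\<lambda>i. [i]) ` {..<d}"
  using assms append_in_graft[of "[]" _ d W]
  by (auto simp: adj_list_graph list_tree_def)

lemma branch_verts_graft:
  assumes W: "\<And>i. i < d \<Longrightarrow> list_tree (W i)" and i: "i < d"
  shows "branch_verts (list_graph (graft d W)) [i] = (\<lambda>l. l @ [i]) ` W i"
proof
  let ?G = "list_graph (graft d W)"
  have Wi: "[] \<in> W i" "\<And>x l. x # l \<in> W i \<Longrightarrow> l \<in> W i"
    using W[OF i] by (auto simp: list_tree_def)
  show "branch_verts ?G [i] \<subseteq> (\<lambda>l. l @ [i]) ` W i"
  proof
    fix w assume "w \<in> branch_verts ?G [i]"
    then have "([i], w) \<in> (off_root_adj ?G)\<^sup>*" by (simp add: branch_verts_def)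
    then show "w \<in> (\<lambda>l. l @ [i]) ` W i"
    proof induction
      case base show ?case using Wi by force
    next
      case (step u w)
      from step.IH obtain l where l: "u = l @ [i]" "l \<in> W i" by blast
      from step.hyps have w: "w \<noteq> []" and "(u, w) \<in> adj ?G" by auto
      then consider x where "u = x # w" | x where "w = x # u" "w \<in> graft d W"
        by (auto simp: adj_list_graph)
      then show ?case
      proof cases
        case 1
        with l w obtain l' where "l = x # l'" "w = l' @ [i]" by (cases l) auto
        with l Wi show ?thesis by blast
      next
        case 2
        with l append_in_graft[of "x # l" i d W] show ?thesis by force
      qed
    qed
  qed
  show "(\<lambda>l. l @ [i]) ` W i \<subseteq> branch_verts ?G [i]"
  proof
    fix w assume "w \<in> (\<lambda>l. l @ [i]) ` W i"
    then obtain l where "w = l @ [i]" "l \<in> W i" by blast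
    moreover have "l \<in> W i \<Longrightarrow> l @ [i] \<in> branch_verts ?G [i]" for l
    proof (induction l)
      case Nil show ?case by (simp add: branch_verts_self)
    next
      case (Cons x l)
      then have "l @ [i] \<in> branch_verts ?G [i]" using Wi by blast
      moreover have "(l @ [i], (x # l) @ [i]) \<in> off_root_adj ?G"
        using Cons.prems i append_in_graft[of "x # l" i d W] by (simp add: adj_list_graph)
      ultimately show ?case by (rule branch_verts_step)
    qed
    ultimately show "w \<in> branch_verts ?G [i]" by blast
  qed
qed

lemma branch_graft:
  assumes W: "\<And>i. i < d \<Longrightarrow> list_tree (W i)" and i: "i < d"
  shows "branch (list_graph (graft d W)) [i] = map_graph (\<lambda>l. l @ [i]) (list_graph (W i))"
proof -
  let ?f = "\<lambda>l. l @ [i]"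
  have "{e \<in> {{x # l, l} | x l. x # l \<in> graft d W}. e \<subseteq> ?f ` W i} =
      (`) ?f ` {{x # l, l} | x l. x # l \<in> W i}" (is "?L = ?R")
  proof
    show "?L \<subseteq> ?R"
    proof
      fix e assume "e \<in> ?L"
      then obtain x l where e: "e = {x # l, l}" "x # l \<in> ?f ` W i" "l \<in> ?f ` W i" by auto
      then obtain l' where l': "l = ?f l'" by blast
      with e have "x # l' \<in> W i" by auto
      with e l' have "e = ?f ` {x # l', l'}" by auto
      with \<open>x # l' \<in> W i\<close> show "e \<in> ?R" by blast
    qed
    show "?R \<subseteq> ?L"
    proof
      fix e assume "e \<in> ?R"
      then obtain x l where xl: "e = {x # ?f l, ?f l}" "x # l \<in> W i" by auto
      moreover have "l \<in> W i" using xl W[OF i] by (auto simp: list_tree_def)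
      moreover have "x # ?f l \<in> graft d W"
        using xl i append_in_graft[of "x # l" i d W] by simp
      moreover have "x # ?f l \<in> ?f ` W i" using xl by force
      ultimately show "e \<in> ?L" by blast
    qed
  qed
  then show ?thesis
    by (simp add: branch_def map_graph_def branch_verts_graft[OF assms])
qed

lemma matula_graft:
  assumes W: "\<And>i. i < d \<Longrightarrow> list_tree (W i)"
  shows "matula (list_graph (graft d W)) = (\<Prod>i<d. nth_prime (matula (list_graph (W i))))"
proof -
  let ?G = "list_graph (graft d W)"
  have "matula ?G = (\<Prod>v \<in> (\<lambda>i. [i]) ` {..<d}. nth_prime (matula (branch ?G v)))"
    using matula_rooted_tree[OF rooted_tree_list_graph[OF list_tree_graft[OF W]]]
      root_nbrs_graft[OF W] by simp
  also have "\<dots> = (\<Prod>i<d. nth_prime (matula (branch ?G [i])))"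
    by (subst prod.reindex) (auto simp: inj_on_def)
  also have "\<dots> = (\<Prod>i<d. nth_prime (matula (list_graph (W i))))"
    by (rule prod.cong)
      (auto simp: branch_graft[OF W] matula_map_graph inj_on_def rooted_tree_list_graph W)
  finally show ?thesis .
qed

text \<open>Trees for the indices of the prime factors of \<open>n\<close> exist by induction; grafting them onto a
  common root gives a tree for \<open>n\<close>.\<close>

lemma ex_list_tree_matula:
  "n \<ge> 1 \<Longrightarrow> \<exists>V. list_tree V \<and> matula (list_graph V) = n"
proof (induction n rule: less_induct)
  case (less n)
  obtain ps where ps: "mset ps = prime_factorization n" using ex_mset by blast
  have "n = prod_list ps"
    using prod_mset_prime_factorization_nat[of n] less.prems
    by (simp add: prod_mset_prod_list flip: ps)
  then have n: "n = (\<Prod>i<length ps. ps ! i)"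
    by (simp add: prod.list_conv_set_nth atLeast0LessThan)
  have prime: "prime (ps ! i)" "ps ! i dvd n" if "i < length ps" for i
    using nth_mem_mset[OF that] unfolding ps by auto
  have "\<exists>V. list_tree V \<and> matula (list_graph V) = prime_index (ps ! i)" if i: "i < length ps" for i
  proof (rule less.IH)
    show "1 \<le> prime_index (ps ! i)" using prime_index prime i by blast
    have "prime_index (ps ! i) < ps ! i"
      using less_nth_prime[of "prime_index (ps ! i)"] prime_index(1)[OF prime(1)[OF i]] by simp
    also have "ps ! i \<le> n" using prime(2)[OF i] less.prems by (simp add: dvd_imp_le)
    finally show "prime_index (ps ! i) < n" .
  qed
  then obtain W where W: "\<And>i. i < length ps \<Longrightarrow> list_tree (W i)"
    "\<And>i. i < length ps \<Longrightarrow> matula (list_graph (W i)) = prime_index (ps ! i)" by metis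
  have "matula (list_graph (graft (length ps) W)) =
      (\<Prod>i<length ps. nth_prime (matula (list_graph (W i))))"
    by (rule matula_graft[OF W(1)])
  also have "\<dots> = n"
    by (subst n, rule prod.cong) (auto simp: W prime_index prime)
  finally have "matula (list_graph (graft (length ps) W)) = n" .
  moreover have "list_tree (graft (length ps) W)" by (rule list_tree_graft[OF W(1)])
  ultimately show ?case by blast
qed

lemma tau:
  assumes "n \<ge> 1"
  shows "rooted_tree (tau n)" "matula (tau n) = n"
proof -
  obtain V where V: "list_tree V" "matula (list_graph V) = n"
    using ex_list_tree_matula[OF assms] by blast
  let ?T = "map_graph (to_nat :: nat list \<Rightarrow> nat) (list_graph V)"
  have "rooted_tree ?T \<and> matula ?T = n"
    using V rooted_tree_map_graph[OF inj_to_nat rooted_tree_list_graph[OF V(1)]]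
      matula_map_graph[OF inj_to_nat rooted_tree_list_graph[OF V(1)]] by simp
  then have "rooted_tree (tau n) \<and> matula (tau n) = n" unfolding tau_def by (rule someI)
  then show "rooted_tree (tau n)" "matula (tau n) = n" by auto
qed

section \<open>The statistics as functions of the Matula number\<close>

lemma level1_power_sum_matula:
  assumes "rooted_tree T"
  shows "level1_power_sum \<alpha> T =
    (\<Sum>p \<in># prime_factorization (matula T). (1 + real (big_omega (prime_index p))) powr \<alpha>)"
  unfolding level1_power_sum_branches[OF assms]
    sum_root_nbrs_matula[OF assms, symmetric,
      where g = "\<lambda>t. (1 + real (big_omega t)) powr \<alpha>"]
  by (rule sum.cong) (use assms in \<open>auto simp: big_omega_matula rooted_tree_branch\<close>)

lemma A_prime_factorization:
  assumes "n \<ge> 1"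
  shows "A \<alpha> n = (\<Sum>p \<in># prime_factorization n. (1 + real (big_omega (prime_index p))) powr \<alpha>)"
  using level1_power_sum_matula[OF tau(1)[OF assms]] tau(2)[OF assms] by (simp add: A_def)

lemma level1_power_sum_eq_A: "rooted_tree T \<Longrightarrow> level1_power_sum \<alpha> T = A \<alpha> (matula T)"
  by (simp add: level1_power_sum_matula A_prime_factorization[OF matula_pos])

text \<open>The contribution of the edges inside a branch with Matula number \<open>t\<close> to the Randic index of
  the whole tree, in which the root of the branch has one more neighbour.\<close>

definition planted_randic :: "real \<Rightarrow> nat \<Rightarrow> real" where
  "planted_randic \<alpha> t =
    R \<alpha> t + A \<alpha> t * ((1 + real (big_omega t)) powr \<alpha> - real (big_omega t) powr \<alpha>)"

lemma randic_matula_step: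
  assumes T: "rooted_tree T"
    and IH: "\<And>v. v \<in> root_nbrs T \<Longrightarrow> randic \<alpha> (branch T v) = R \<alpha> (matula (branch T v))"
  shows "randic \<alpha> T = real (big_omega (matula T)) powr \<alpha> * A \<alpha> (matula T)
    + (\<Sum>p \<in># prime_factorization (matula T). planted_randic \<alpha> (prime_index p))"
proof -
  have "planted_randic \<alpha> (matula (branch T v)) =
      randic \<alpha> (branch T v) + level1_power_sum \<alpha> (branch T v) *
        ((1 + real (card (root_nbrs (branch T v)))) powr \<alpha>
          - real (card (root_nbrs (branch T v))) powr \<alpha>)" if "v \<in> root_nbrs T" for v
    using rooted_tree_branch[OF T that] IH[OF that]
    by (simp add: planted_randic_def level1_power_sum_eq_A big_omega_matula)
  then show ?thesis
    using T by (simp add: randic_branches level1_power_sum_eq_A big_omega_matula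
        flip: sum_root_nbrs_matula)
qed

text \<open>The tree \<open>T\<close> and the representative chosen by \<open>tau\<close> have branches with smaller Matula numbers.
  By induction the two Randic indices are thus given by the same expression in \<open>matula T\<close>.\<close>

lemma randic_eq_R:
  fixes T :: "nat rooted_graph"
  assumes "rooted_tree T"
  shows "randic \<alpha> T = R \<alpha> (matula T)"
  using assms
proof (induction "matula T" arbitrary: T rule: less_induct)
  case less
  let ?S = "tau (matula T)"
  have S: "rooted_tree ?S" "matula ?S = matula T" using tau matula_pos less.prems by blast+
  have IH: "randic \<alpha> (branch T' v) = R \<alpha> (matula (branch T' v))"
    if "rooted_tree T'" "matula T' = matula T" "v \<in> root_nbrs T'" for T' :: "nat rooted_graph" and v
    using less.hyps matula_branch_less rooted_tree_branch that by metis
  have "randic \<alpha> T = randic \<alpha> ?S"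
    using randic_matula_step[OF less.prems IH[OF less.prems]] randic_matula_step[OF S(1) IH[OF S]]
    by (simp only: S(2))
  then show ?case by (simp add: R_def)
qed

lemma R_prime_factorization:
  assumes "n \<ge> 1"
  shows "R \<alpha> n = real (big_omega n) powr \<alpha> * A \<alpha> n
    + (\<Sum>p \<in># prime_factorization n. planted_randic \<alpha> (prime_index p))"
proof -
  have "randic \<alpha> (tau n) = real (big_omega (matula (tau n))) powr \<alpha> * A \<alpha> (matula (tau n))
    + (\<Sum>p \<in># prime_factorization (matula (tau n)). planted_randic \<alpha> (prime_index p))"
    by (rule randic_matula_step)
      (use tau[OF assms] in \<open>auto intro!: randic_eq_R rooted_tree_branch\<close>)
  with tau[OF assms] show ?thesis by (simp add: R_def)
qed

theorem proposition3p24: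
  fixes \<alpha> :: real and n :: nat
  assumes "n \<ge> 1"
  shows "(n = 1 \<longrightarrow> R \<alpha> n = 0) \<and>
    (\<forall>t::nat. t \<ge> 1 \<and> n = nth_prime t \<longrightarrow>
       R \<alpha> n = R \<alpha> t
         + (if t = 1 then 0
            else A \<alpha> t * ((1 + real (big_omega t)) powr \<alpha> - real (big_omega t) powr \<alpha>))
         + (1 + real (big_omega t)) powr \<alpha>) \<and>
    (\<forall>r s::nat. r \<ge> 2 \<and> s \<ge> 2 \<and> n = r * s \<longrightarrow>
       R \<alpha> n = R \<alpha> r + R \<alpha> s
         + A \<alpha> r * (real (big_omega n) powr \<alpha> - real (big_omega r) powr \<alpha>)
         + A \<alpha> s * (real (big_omega n) powr \<alpha> - real (big_omega s) powr \<alpha>))"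
proof (intro conjI allI impI)
  assume "n = 1"
  then show "R \<alpha> n = 0" by (simp add: R_prime_factorization big_omega_def)
next
  fix t :: nat
  assume t: "t \<ge> 1 \<and> n = nth_prime t"
  have pf: "prime_factorization n = {#n#}"
    using t prime_nth_prime by (simp add: prime_factorization_prime)
  have ix: "prime_index n = t" using t by (simp add: prime_index_nth_prime)
  \<comment> \<open>for \<open>t = 1\<close> the middle term vanishes because its first factor does\<close>
  have A1: "A \<alpha> 1 = 0" by (simp add: A_prime_factorization)
  have "R \<alpha> n = (1 + real (big_omega t)) powr \<alpha> + planted_randic \<alpha> t"
    by (simp add: R_prime_factorization[OF assms] A_prime_factorization[OF assms]
        pf ix big_omega_def)
  then show "R \<alpha> n = R \<alpha> t
         + (if t = 1 then 0
            else A \<alpha> t * ((1 + real (big_omega t)) powr \<alpha> - real (big_omega t) powr \<alpha>))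
         + (1 + real (big_omega t)) powr \<alpha>"
    using A1 by (simp add: planted_randic_def)
next
  fix r s :: nat
  assume rs: "r \<ge> 2 \<and> s \<ge> 2 \<and> n = r * s"
  then have pos: "r \<ge> 1" "s \<ge> 1" by auto
  have pf: "prime_factorization n = prime_factorization r + prime_factorization s"
    using rs by (simp add: prime_factorization_mult)
  have "A \<alpha> n = A \<alpha> r + A \<alpha> s"
    by (simp add: A_prime_factorization[OF assms] A_prime_factorization[OF pos(1)]
        A_prime_factorization[OF pos(2)] pf)
  then show "R \<alpha> n = R \<alpha> r + R \<alpha> s
         + A \<alpha> r * (real (big_omega n) powr \<alpha> - real (big_omega r) powr \<alpha>)
         + A \<alpha> s * (real (big_omega n) powr \<alpha> - real (big_omega s) powr \<alpha>)"
    unfolding R_prime_factorization[OF assms] R_prime_factorization[OF pos(1)]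
      R_prime_factorization[OF pos(2)]
    by (simp add: pf algebra_simps)
qed

end
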